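(* Let $\lambda$ be a nonzero real number. For every integer $n\ge 0$, $$(1)_{n,\lambda}=\sum_{m=0}^{n}\mathrm{Bel}_{m,\lambda}S_{1,\lambda}(n,m),$$ and $$\mathrm{Bel}_{n,\lambda}=\sum_{m=0}^{n}(1)_{m,\lambda}S_{2,\lambda}(n,m).$$
   Context: For a nonzero real $\lambda$, the degenerate falling factorial is $(x)_{0,\lambda}=1$ and $(x)_{n,\lambda}=x(x-\lambda)\cdots(x-(n-1)\lambda)$ for $n\ge1$. The degenerate exponential function is $e_{\lambda}^{x}(t)=(1+\lambda t)^{x/\lambda}=\sum_{n\ge0}(x)_{n,\lambda}\frac{t^n}{n!}$, $e_\lambda(t)=e_\lambda^1(t)$, and $\log_\lambda(t)=\frac{t^\lambda-1}{\lambda}$ is the compositional inverse of $e_\lambda(t)$. The fully degenerate Bell polynomials are defined by $e_{\lambda}(x(e_{\lambda}(t)-1))=\sum_{n\ge0}\mathrm{Bel}_{n,\lambda}(x)\frac{t^n}{n!}$, and $\mathrm{Bel}_{n,\lambda}=\mathrm{Bel}_{n,\lambda}(1)$. The degenerate Stirling numbers of the first kind are defined by $\frac{1}{m!}(\log_\lambda(1+t))^m=\sum_{n\ge m}S_{1,\lambda}(n,m)\frac{t^n}{n!}$, and those of the second kind by $\frac{1}{m!}(e_{\lambda}(t)-1)^m=\sum_{n\ge m}S_{2,\lambda}(n,m)\frac{t^n}{n!}$, for $m\ge0$. *)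

theory Defs
  imports "HOL-Analysis.Analysis"
begin

text \<open>
  All generating functions are formal power series in \<open>t\<close>; \<open>fps_binomial a\<close> is the series
  of \<open>(1 + t)\<^sup>a\<close>. The parameter \<open>l\<close> is the (nonzero) degeneracy parameter lambda.
\<close>

definition dfall :: "real \<Rightarrow> real \<Rightarrow> nat \<Rightarrow> real" where
  "dfall l x n = (\<Prod>i<n. x - real i * l)"

text \<open>\<open>e\<^sub>l\<^sup>x(t) = (1 + l t)\<^bsup>x/l\<^esup>\<close>\<close>

definition dexp :: "real \<Rightarrow> real \<Rightarrow> real fps" where
  "dexp l x = fps_binomial (x / l) oo (fps_const l * fps_X)"

text \<open>
  The logarithm \<open>(t\<^sup>l - 1) / l\<close> has no expansion at \<open>0\<close>; as in its use below, the series is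
  that of its value at \<open>1 + t\<close>.
\<close>

definition dlog1p :: "real \<Rightarrow> real fps" where
  "dlog1p l = fps_const (1 / l) * (fps_binomial l - 1)"

text \<open>
  The inner series \<open>x (e\<^sub>l(t) - 1)\<close> has zero constant term, so the composition below is a
  genuine substitution. A factor \<open>fact n\<close> turns an ordinary coefficient into that of \<open>t\<^sup>n / n!\<close>.
\<close>

definition Bel_poly :: "real \<Rightarrow> nat \<Rightarrow> real \<Rightarrow> real" where
  "Bel_poly l n x = fact n * fps_nth (dexp l 1 oo (fps_const x * (dexp l 1 - 1))) n"

definition Bel :: "real \<Rightarrow> nat \<Rightarrow> real" where
  "Bel l n = Bel_poly l n 1"

definition dStirling1 :: "real \<Rightarrow> nat \<Rightarrow> nat \<Rightarrow> real" where
  "dStirling1 l n m = fact n * fps_nth (fps_const (1 / fact m) * dlog1p l ^ m) n"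

definition dStirling2 :: "real \<Rightarrow> nat \<Rightarrow> nat \<Rightarrow> real" where
  "dStirling2 l n m = fact n * fps_nth (fps_const (1 / fact m) * (dexp l 1 - 1) ^ m) n"

lemma dexp_eq_dfall_series:
  assumes "l \<noteq> 0"
  shows "dexp l x = Abs_fps (\<lambda>n. dfall l x n / fact n)"
proof (rule fps_ext)
  fix n
  have "l ^ n * (\<Prod>i<n. x / l - real i) = (\<Prod>i<n. l * (x / l - real i))"
    by (simp add: prod.distrib)
  also have "\<dots> = dfall l x n"
    unfolding dfall_def using assms by (intro prod.cong) (auto simp: field_simps)
  finally show "fps_nth (dexp l x) n = fps_nth (Abs_fps (\<lambda>n. dfall l x n / fact n)) n"
    by (simp add: dexp_def gbinomial_prod_rev atLeast0LessThan)
qed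

lemma dexp_sums:
  assumes "\<bar>l * t\<bar> < 1"
  shows "(\<lambda>n. fps_nth (dexp l x) n * t ^ n) sums (1 + l * t) powr (x / l)"
proof -
  have "fps_nth (dexp l x) n * t ^ n = (x / l gchoose n) * (l * t) ^ n" for n
    by (simp add: dexp_def power_mult_distrib)
  then show ?thesis
    using gen_binomial_real[OF assms, of "x / l"] by simp
qed

lemma dlog1p_sums:
  assumes "\<bar>t\<bar> < 1"
  shows "(\<lambda>n. fps_nth (dlog1p l) n * t ^ n) sums (((1 + t) powr l - 1) / l)"
proof -
  have one: "(\<lambda>n. if n = 0 then 1 else 0 :: real) sums 1"
    using sums_single[of 0 "\<lambda>_. 1 :: real"] by simp
  have "(\<lambda>n. 1 / l * ((l gchoose n) * t ^ n - (if n = 0 then 1 else 0)))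
          sums (1 / l * ((1 + t) powr l - 1))"
    by (intro sums_mult sums_diff gen_binomial_real assms one)
  moreover have "fps_nth (dlog1p l) n * t ^ n = 1 / l * ((l gchoose n) * t ^ n - (if n = 0 then 1 else 0))"
    for n by (simp add: dlog1p_def algebra_simps)
  ultimately show ?thesis by simp
qed

end

theory Submission
  imports Defs
begin

text \<open>
  Since \<open>e\<^sub>l(t) - 1\<close> and \<open>log\<^sub>l(1 + t)\<close> are compositional inverses, substituting the logarithm into
  the generating function \<open>e\<^sub>l(e\<^sub>l(t) - 1)\<close> of the Bell numbers gives back \<open>e\<^sub>l(t)\<close>. Both identities
  are comparisons of coefficients, because the numbers \<open>S\<^sub>1\<close> and \<open>S\<^sub>2\<close> are the coefficients of the
  powers of the inner series of a composition.
\<close>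

text \<open>This is \<open>((1 + t)^b)^a = (1 + t)^(a * b)\<close>: the composition \<open>F\<close>
  has constant term 1 and satisfies \<open>(1 + t) F' = a b F\<close>, which determines it.\<close>

lemma fps_binomial_compose:
  fixes a b :: "'a :: field_char_0"
  shows "fps_binomial a oo (fps_binomial b - 1) = fps_binomial (a * b)"
proof -
  let ?P = "1 + fps_X :: 'a fps"
  let ?G = "fps_binomial b - 1"
  let ?F = "fps_binomial a oo ?G"
  let ?D = "fps_deriv (fps_binomial a) oo ?G"
  have P0: "fps_nth ?P 0 \<noteq> 0" by simp
  then have P: "?P \<noteq> 0" by (metis fps_zero_nth)
  have B: "fps_binomial b \<noteq> 0"
    by (metis fps_binomial_nth fps_zero_nth gbinomial_0(1) zero_neq_one)
  have ode: "?P * fps_deriv (fps_binomial c) = fps_const c * fps_binomial c" for c :: 'a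
    using P0 P by (simp add: fps_binomial_deriv fps_divide_unit inverse_mult_eq_1' mult.left_commute)
  have "?P oo ?G = fps_binomial b"
    by (simp add: fps_compose_add_distrib fps_X_fps_compose_startby0)
  then have D: "fps_binomial b * ?D = fps_const a * ?F"
    using arg_cong[OF ode[of a], of "\<lambda>f. f oo ?G"] by (simp add: fps_compose_mult_distrib)
  \<comment> \<open>The extra factor \<open>fps_binomial b\<close> lets \<open>D\<close> apply after
    the chain rule; it is nonzero and cancels.\<close>
  have "fps_binomial b * (?P * fps_deriv ?F)
      = (fps_binomial b * ?D) * (?P * fps_deriv (fps_binomial b))"
    by (simp add: fps_compose_deriv mult_ac)
  also have "\<dots> = fps_binomial b * (fps_const (a * b) * ?F)"
    unfolding D ode by (simp add: mult_ac flip: fps_const_mult)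
  finally have "?P * fps_deriv ?F = fps_const (a * b) * ?F"
    using B by simp
  then have "fps_deriv ?F = fps_const (a * b) * ?F / ?P"
    using P by (metis nonzero_mult_div_cancel_left)
  then show ?thesis
    using fps_binomial_ODE_unique'[of ?F "a * b"] by simp
qed

text \<open>The factors \<open>l\<close> and \<open>1 / l\<close> cancel, leaving binomial series
  with exponents \<open>1 / l\<close> and \<open>l\<close>, whose composition is
  \<open>1 + t\<close>.\<close>

lemma dexp_minus_1_compose_dlog1p:
  assumes "l \<noteq> 0"
  shows "(dexp l 1 - 1) oo dlog1p l = fps_X"
proof -
  have L0: "fps_nth (dlog1p l) 0 = 0" by (simp add: dlog1p_def)
  have "fps_const l * fps_X oo dlog1p l = fps_const l * dlog1p l"
    using L0 by (simp add: fps_compose_mult_distrib fps_X_fps_compose_startby0)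
  also have "\<dots> = fps_binomial l - 1"
    using assms by (simp add: dlog1p_def flip: mult.assoc)
  finally have "dexp l 1 oo dlog1p l = fps_binomial (1 / l) oo (fps_binomial l - 1)"
    using L0 by (simp add: dexp_def flip: fps_compose_assoc)
  also have "\<dots> = 1 + fps_X"
    using assms fps_binomial_of_nat[of 1] by (simp add: fps_binomial_compose)
  finally show ?thesis
    by (simp add: fps_compose_sub_distrib)
qed

theorem theorem7:
  fixes l :: real and n :: nat
  assumes "l \<noteq> 0"
  shows "dfall l 1 n = (\<Sum>m=0..n. Bel l m * dStirling1 l n m) \<and>
         Bel l n = (\<Sum>m=0..n. dfall l 1 m * dStirling2 l n m)"
proof
  let ?E = "dexp l 1"
  have E: "dfall l 1 m = fact m * fps_nth ?E m" for m
    using assms by (simp add: dexp_eq_dfall_series)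
  have Bel: "Bel l m = fact m * fps_nth (?E oo (?E - 1)) m" for m
    by (simp add: Bel_def Bel_poly_def)
  have E0: "fps_nth (?E - 1) 0 = 0" by (simp add: dexp_def)
  have L0: "fps_nth (dlog1p l) 0 = 0" by (simp add: dlog1p_def)
  have "?E = ?E oo (?E - 1) oo dlog1p l"
    using dexp_minus_1_compose_dlog1p[OF assms] fps_compose_assoc[OF L0 E0, of ?E] by simp
  then have "dfall l 1 n = fact n * fps_nth (?E oo (?E - 1) oo dlog1p l) n"
    by (simp add: E)
  also have "\<dots> = (\<Sum>m=0..n. Bel l m * dStirling1 l n m)"
    \<comment> \<open>Fixing the outer series expands only the outermost composition, so the inner
      one still matches \<open>Bel\<close>.\<close>
    unfolding fps_compose_nth[of "?E oo (?E - 1)"]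
    by (simp add: Bel dStirling1_def sum_distrib_left mult_ac)
  finally show "dfall l 1 n = (\<Sum>m=0..n. Bel l m * dStirling1 l n m)" .
  show "Bel l n = (\<Sum>m=0..n. dfall l 1 m * dStirling2 l n m)"
    by (simp add: Bel E fps_compose_nth dStirling2_def sum_distrib_left mult_ac)
qed

end
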